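(* Let $\Gamma\subset\mathbb{R}^d$ be an acute closed convex solid cone, let $A=(A_1,\dots,A_d)$ be a $d$-tuple of real symmetric matrices of the same size, and let $L(x)=x\cdot A=\sum_{j=1}^dx_jA_j$, $x\in\mathbb{R}^d$. Suppose that the matrix $L(p)$ is positive semi-definite for every vector $p$ lying on an extreme ray of $\Gamma$. Suppose further that there exists a set of $d$ linearly independent vectors $v^{(1)},\dots,v^{(d)}$ chosen from the extreme rays of $\Gamma$ such that for every pair of indices $i,j\in\{1,\dots,d\}$ the Weyl-symmetrized words $C_{k,1}(L(v^{(i)}),L(v^{(j)}))$ are positive semi-definite for all $k\ge1$. Then $A_1,\dots,A_d$ mutually commute, and all their joint eigenvalues lie in $\Gamma^*$.
   Context: Acute means containing no line; solid means with non-empty interior. $\Gamma^*=\{y\in\mathbb{R}^d: y\cdot x\ge 0\ \forall x\in\Gamma\}$. For square matrices $X,Y$ of the same size, the Weyl-symmetrized word $C_{k,1}(X,Y)$ is the coefficient of $s^kt$ in the expansion of $(sX+tY)^{k+1}$, i.e. $C_{k,1}(X,Y)=\sum_{j=0}^kX^{k-j}YX^j$. A joint eigenvalue of $A$ is a vector $(\lambda_1,\dots,\lambda_d)\in\mathbb{R}^d$ such that $A_ju=\lambda_ju$ for all $j$, for some common vector $u\ne0$. *)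

theory Defs
  imports "HOL-Analysis.Analysis"
begin

definition contains_line :: "'a::real_vector set \<Rightarrow> bool" where
  "contains_line S \<longleftrightarrow> (\<exists>a u. u \<noteq> 0 \<and> (\<forall>t::real. a + t *\<^sub>R u \<in> S))"

definition extreme_ray_of :: "'a::real_vector set \<Rightarrow> 'a set \<Rightarrow> bool" (infixr "extreme'_ray'_of" 50) where
  "R extreme_ray_of \<Gamma> \<longleftrightarrow>
     (\<exists>v. v \<noteq> 0 \<and> R = {t *\<^sub>R v | t. t \<ge> 0}) \<and> R face_of \<Gamma>"

definition dual_cone :: "'a::real_inner set \<Rightarrow> 'a set" where
  "dual_cone \<Gamma> = {y. \<forall>x\<in>\<Gamma>. 0 \<le> y \<bullet> x}"

definition pos_semidef :: "real^'n^'n \<Rightarrow> bool" where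
  "pos_semidef M \<longleftrightarrow> transpose M = M \<and> (\<forall>u. 0 \<le> u \<bullet> (M *v u))"

(* The power X ^ k of the type class monoid_mult is entrywise on matrices. *)
primrec mat_pow :: "real^'n^'n \<Rightarrow> nat \<Rightarrow> real^'n^'n" where
  "mat_pow X 0 = mat 1"
| "mat_pow X (Suc k) = X ** mat_pow X k"

(* C_{k,1}(X,Y): the coefficient of s^k t in (sX + tY)^(k+1). *)
definition weyl_word :: "nat \<Rightarrow> real^'n^'n \<Rightarrow> real^'n^'n \<Rightarrow> real^'n^'n" where
  "weyl_word k X Y = (\<Sum>j\<le>k. mat_pow X (k - j) ** Y ** mat_pow X j)"

definition lin_pencil :: "('d \<Rightarrow> real^'n^'n) \<Rightarrow> real^'d \<Rightarrow> real^'n^'n" where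
  "lin_pencil A x = (\<Sum>j\<in>UNIV. (x $ j) *\<^sub>R A j)"

definition joint_eigenvalue :: "('d \<Rightarrow> real^'n^'n) \<Rightarrow> real^'d \<Rightarrow> bool" where
  "joint_eigenvalue A \<mu> \<longleftrightarrow> (\<exists>u. u \<noteq> 0 \<and> (\<forall>j. A j *v u = (\<mu> $ j) *\<^sub>R u))"

end

theory Submission
  imports Defs
begin

text \<open>
  Let \<open>X\<close> be positive semidefinite, \<open>Y\<close> symmetric, and \<open>X u = l u\<close>, \<open>X w = m w\<close> with \<open>m < l\<close>.
  Then \<open>w \<bullet> C_{k,1}(X,Y) u = (\<Sum>j. m^(k-j) l^j) (w \<bullet> Y u)\<close>, where the factor is at least
  \<open>l^k\<close>, while the two diagonal entries of the form are \<open>(k+1) m^k (w \<bullet> Y w)\<close> and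
  \<open>(k+1) l^k (u \<bullet> Y u)\<close>.  By Cauchy-Schwarz for the semidefinite form,
  \<open>(w \<bullet> Y u)^2\<close> is at most a constant times \<open>(k+1)^2 (m/l)^k\<close>, which tends to \<open>0\<close>.  So \<open>Y\<close>
  preserves the eigenspaces of \<open>X\<close>, i.e. commutes with \<open>X\<close>.

  A closed cone without lines has a compact base, whose extreme points span extreme rays;
  by Krein-Milman a linear functional nonnegative on the extreme rays is nonnegative on the cone.
\<close>

section \<open>Symmetric and positive semidefinite matrices\<close>

text \<open>For \<open>c > 0\<close> the bound is nonnegativity at the vertex
  \<open>- b / c\<close>. It serves twice: for Cauchy-Schwarz, and as the first-order condition at
  the maximum of a quadratic form.\<close>

lemma quadratic_nonneg_imp_discriminant:
  fixes a b c :: real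
  assumes "\<And>t. 0 \<le> a + 2 * t * b + t\<^sup>2 * c"
  shows "b\<^sup>2 \<le> a * c"
proof (cases "c = 0")
  case True
  have "b = 0"
  proof (rule ccontr)
    assume "b \<noteq> 0"
    \<comment> \<open>At the chosen argument the remaining linear polynomial takes the value
      -1.\<close>
    then show False
      using assms[of "- (a + 1) / (2 * b)"] True by (simp add: field_simps)
  qed
  then show ?thesis using True by simp
next
  case False
  have "c > 0"
  proof (rule ccontr)
    assume "\<not> c > 0"
    then have c: "c < 0" using False by simp
    have a: "a \<ge> 0" using assms[of 0] by simp
    \<comment> \<open>This makes the quadratic term \<open>- (a + 1)\<close>; adding the values at
      \<open>t\<close> and \<open>- t\<close> then cancels the linear terms and leaves -2.\<close>
    define t where "t = sqrt ((a + 1) / (- c))"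
    have "0 \<le> (a + 1) / (- c)" using a c by (intro divide_nonneg_nonneg) auto
    then have "t\<^sup>2 = (a + 1) / (- c)" unfolding t_def by (rule real_sqrt_pow2)
    then have "t\<^sup>2 * c = - (a + 1)" using c by simp
    then have "0 \<le> a + 2 * t * b - (a + 1)" "0 \<le> a - 2 * t * b - (a + 1)"
      using assms[of t] assms[of "- t"] by simp_all
    then show False by simp
  qed
  moreover have "0 \<le> a - b\<^sup>2 / c"
    using assms[of "- b / c"] False by (simp add: power2_eq_square field_simps)
  ultimately show ?thesis by (simp add: field_simps)
qed

lemma symmetric_inner_swap:
  fixes X :: "real^'n^'n"
  assumes "transpose X = X"
  shows "w \<bullet> (X *v z) = (X *v w) \<bullet> z"
  by (metis assms dot_lmul_matrix vector_transpose_matrix)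

lemma quadratic_form_add_scaleR:
  fixes M :: "real^'n^'n"
  assumes "transpose M = M"
  shows "(x + t *\<^sub>R y) \<bullet> (M *v (x + t *\<^sub>R y)) =
    x \<bullet> (M *v x) + 2 * t * (x \<bullet> (M *v y)) + t\<^sup>2 * (y \<bullet> (M *v y))"
  using symmetric_inner_swap[OF assms, of y x]
  by (simp add: matrix_vector_right_distrib matrix_vector_mult_scaleR inner_add_left
      inner_add_right power2_eq_square inner_commute algebra_simps)

lemma pos_semidef_Cauchy_Schwarz:
  assumes "pos_semidef M"
  shows "(w \<bullet> (M *v u))\<^sup>2 \<le> (w \<bullet> (M *v w)) * (u \<bullet> (M *v u))"
proof (rule quadratic_nonneg_imp_discriminant)
  fix t
  show "0 \<le> w \<bullet> (M *v w) + 2 * t * (w \<bullet> (M *v u)) + t\<^sup>2 * (u \<bullet> (M *v u))"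
    using assms quadratic_form_add_scaleR[of M w t u] unfolding pos_semidef_def by metis
qed

lemma pos_semidef_eigenvalue_nonneg:
  assumes "pos_semidef M" and "M *v u = l *\<^sub>R u" and "u \<noteq> 0"
  shows "0 \<le> l"
proof -
  have "0 \<le> l * (u \<bullet> u)"
    using assms(1,2) unfolding pos_semidef_def by (metis inner_scaleR_right)
  moreover have "0 < u \<bullet> u" using assms(3) by simp
  ultimately show ?thesis by (simp add: zero_le_mult_iff)
qed

text \<open>Rayleigh quotient: the form \<open>x \<bullet> (X *v x)\<close> attains its maximum
  \<open>l\<close> on the compact unit sphere of \<open>W\<close>, and a maximizer is an
  eigenvector.\<close>

lemma symmetric_eigenvector_in_invariant_subspace:
  fixes X :: "real^'n^'n"
  assumes sym: "transpose X = X" and W: "subspace W" "W \<noteq> {0}"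
    and inv: "\<And>x. x \<in> W \<Longrightarrow> X *v x \<in> W"
  obtains l u where "u \<in> W" "u \<noteq> 0" "X *v u = l *\<^sub>R u"
proof -
  obtain z where z: "z \<in> W" "z \<noteq> 0" using W subspace_0 by blast
  have "compact (sphere 0 1 \<inter> W)"
    by (simp add: closed_subspace W compact_Int_closed)
  moreover have "z /\<^sub>R norm z \<in> sphere 0 1 \<inter> W"
    using z W by (simp add: subspace_scale)
  then have "sphere 0 1 \<inter> W \<noteq> {}" by blast
  moreover have "continuous_on (sphere 0 1 \<inter> W) (\<lambda>x. x \<bullet> (X *v x))"
    by (intro continuous_intros linear_continuous_on)
      (simp add: linear_linear[symmetric])
  ultimately obtain u where u: "u \<in> sphere 0 1 \<inter> W"
    and max: "\<And>x. x \<in> sphere 0 1 \<inter> W \<Longrightarrow> x \<bullet> (X *v x) \<le> u \<bullet> (X *v u)"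
    using continuous_attains_sup by (metis (no_types, lifting))
  define l where "l = u \<bullet> (X *v u)"
  have uu: "u \<bullet> u = 1" using u by (simp add: norm_eq_1)
  have bound: "y \<bullet> (X *v y) \<le> l * (y \<bullet> y)" if "y \<in> W" for y
  proof (cases "y = 0")
    case False
    then have "y /\<^sub>R norm y \<in> sphere 0 1 \<inter> W"
      using that W by (simp add: subspace_scale)
    from max[OF this] have "(y \<bullet> (X *v y)) / (norm y)\<^sup>2 \<le> l"
      by (simp add: l_def matrix_vector_mult_scaleR power2_eq_square field_simps)
    then show ?thesis using False by (simp add: field_simps power2_norm_eq_inner)
  qed simp
  \<comment> \<open>The residual of the eigenvalue equation stays in \<open>W\<close> by invariance,
    so it is an admissible direction of variation.\<close>
  define y where "y = l *\<^sub>R u - X *v u"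
  have yW: "y \<in> W" unfolding y_def
    using u W inv by (simp add: subspace_diff subspace_scale)
  \<comment> \<open>Cauchy-Schwarz on \<open>W\<close> for the nonnegative form
    \<open>l * (x \<bullet> x) - x \<bullet> (X *v x)\<close>, which vanishes at the maximizer
    \<open>u\<close>; hence the factor 0.\<close>
  have "(u \<bullet> y * l - u \<bullet> (X *v y))\<^sup>2 \<le> 0 * (l * (y \<bullet> y) - y \<bullet> (X *v y))"
  proof (rule quadratic_nonneg_imp_discriminant)
    fix t
    have "u + t *\<^sub>R y \<in> W"
      using u yW W by (simp add: subspace_add subspace_scale)
    from bound[OF this]
    show "0 \<le> 0 + 2 * t * (u \<bullet> y * l - u \<bullet> (X *v y)) + t\<^sup>2 * (l * (y \<bullet> y) - y \<bullet> (X *v y))"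
      unfolding quadratic_form_add_scaleR[OF sym] l_def[symmetric]
      using uu by (simp add: inner_add_left inner_add_right inner_commute power2_eq_square
          algebra_simps)
  qed
  then have "(l *\<^sub>R u) \<bullet> y = (X *v u) \<bullet> y"
    using symmetric_inner_swap[OF sym, of u y] by (simp add: mult.commute)
  then have "(l *\<^sub>R u - X *v u) \<bullet> y = 0"
    unfolding inner_diff_left by simp
  then have "y \<bullet> y = 0" by (simp only: y_def[symmetric])
  then have "X *v u = l *\<^sub>R u" by (simp add: y_def)
  moreover have "u \<noteq> 0" using uu by auto
  ultimately show thesis using that u by blast
qed

text \<open>By symmetry the orthogonal complement of the eigenvectors is invariant under
  \<open>X\<close>. Were it nonzero, it would contain an eigenvector, orthogonal to itself.\<close>

lemma span_eigenvectors_symmetric: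
  fixes X :: "real^'n^'n"
  assumes sym: "transpose X = X"
  shows "span {u. \<exists>l. X *v u = l *\<^sub>R u} = UNIV" (is "span ?E = _")
proof (rule ccontr)
  assume "span ?E \<noteq> UNIV"
  then obtain a where a: "a \<noteq> 0" "\<And>x. x \<in> span ?E \<Longrightarrow> a \<bullet> x = 0"
    using span_not_UNIV_orthogonal by blast
  define W where "W = {y. \<forall>x\<in>?E. orthogonal x y}"
  have "subspace W" unfolding W_def by (rule subspace_orthogonal_to_vectors)
  moreover have "a \<in> W"
    unfolding W_def orthogonal_def using a(2)[OF span_base] by (auto simp: inner_commute[of _ a])
  then have "W \<noteq> {0}" using a(1) by blast
  moreover have "X *v y \<in> W" if "y \<in> W" for y
    unfolding W_def orthogonal_def
  proof clarify
    fix x l assume x: "X *v x = l *\<^sub>R x"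
    then have "x \<bullet> y = 0" using that unfolding W_def orthogonal_def by blast
    then show "x \<bullet> (X *v y) = 0"
      unfolding symmetric_inner_swap[OF sym] x by simp
  qed
  ultimately obtain l u where u: "u \<in> W" "u \<noteq> 0" "X *v u = l *\<^sub>R u"
    by (rule symmetric_eigenvector_in_invariant_subspace[OF sym])
  then have "orthogonal u u" unfolding W_def by blast
  then show False using u by (simp add: orthogonal_def)
qed

section \<open>Weyl words and commutation\<close>

lemma mat_pow_eigenvector:
  assumes "X *v u = l *\<^sub>R u"
  shows "mat_pow X k *v u = l ^ k *\<^sub>R u"
  by (induction k)
    (simp_all add: matrix_vector_mul_assoc[symmetric] matrix_vector_mult_scaleR assms mult.commute)

lemma inner_mat_pow_eigenvector:
  assumes "transpose X = X" and "X *v w = m *\<^sub>R w"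
  shows "w \<bullet> (mat_pow X k *v z) = m ^ k * (w \<bullet> z)"
  by (induction k)
    (simp_all add: matrix_vector_mul_assoc[symmetric] symmetric_inner_swap[OF assms(1)] assms(2))

lemma matrix_vector_mult_sum_left:
  fixes F :: "'i \<Rightarrow> real^'n^'m"
  assumes "finite S"
  shows "(\<Sum>j\<in>S. F j) *v u = (\<Sum>j\<in>S. F j *v u)"
  using assms by induction (simp_all add: matrix_vector_mult_add_rdistrib)

text \<open>In each summand the right power of \<open>X\<close> acts on \<open>u\<close>, and the
  left power is moved across the inner product onto \<open>w\<close>; both become scalars.\<close>

lemma weyl_word_eigenvectors:
  assumes "transpose X = X" "X *v w = m *\<^sub>R w" "X *v u = l *\<^sub>R u"
  shows "w \<bullet> (weyl_word k X Y *v u) = (\<Sum>j\<le>k. m ^ (k - j) * l ^ j) * (w \<bullet> (Y *v u))"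
  by (simp add: weyl_word_def matrix_vector_mult_sum_left inner_sum_right sum_distrib_left
      matrix_vector_mul_assoc[symmetric] mat_pow_eigenvector[OF assms(3)]
      inner_mat_pow_eigenvector[OF assms(1,2)] matrix_vector_mult_scaleR ac_simps)

lemma weyl_word_eigenvectors_orthogonal:
  fixes X Y :: "real^'n^'n"
  assumes X: "pos_semidef X"
    and words: "\<And>k. k \<ge> 1 \<Longrightarrow> pos_semidef (weyl_word k X Y)"
    and w: "X *v w = m *\<^sub>R w" "w \<noteq> 0" and u: "X *v u = l *\<^sub>R u" and ml: "m < l"
  shows "w \<bullet> (Y *v u) = 0"
proof -
  define c where "c = w \<bullet> (Y *v u)"
  define K where "K = (w \<bullet> (Y *v w)) * (u \<bullet> (Y *v u))"
  have sym: "transpose X = X" using X by (simp add: pos_semidef_def)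
  have m0: "0 \<le> m" by (rule pos_semidef_eigenvalue_nonneg[OF X w])
  have diag: "z \<bullet> (weyl_word k X Y *v z) = (real k + 1) * p ^ k * (z \<bullet> (Y *v z))"
    if "X *v z = p *\<^sub>R z" for z p k
  proof -
    have "(\<Sum>j\<le>k. p ^ (k - j) * p ^ j) = (\<Sum>j\<le>k. p ^ k)"
      by (intro sum.cong refl) (simp add: power_add[symmetric])
    then show ?thesis by (simp add: weyl_word_eigenvectors[OF sym that that])
  qed
  have bound: "c\<^sup>2 \<le> (real k + 1)\<^sup>2 * (m / l) ^ k * K" if "k \<ge> 1" for k
  proof -
    define h where "h = (\<Sum>j\<le>k. m ^ (k - j) * l ^ j)"
    \<comment> \<open>The summand with \<open>j = k\<close> is \<open>l ^ k\<close>, and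
      \<open>m0\<close> keeps the others nonnegative.\<close>
    have "l ^ k \<le> h"
      unfolding h_def using member_le_sum[of k "{..k}" "\<lambda>j. m ^ (k - j) * l ^ j"] m0 ml by simp
    then have "(l ^ k)\<^sup>2 * c\<^sup>2 \<le> h\<^sup>2 * c\<^sup>2"
      using m0 ml by (intro mult_right_mono power_mono) auto
    also have "\<dots> \<le> ((real k + 1) * m ^ k * (w \<bullet> (Y *v w))) * ((real k + 1) * l ^ k * (u \<bullet> (Y *v u)))"
      using pos_semidef_Cauchy_Schwarz[OF words[OF that], of w u]
      by (simp add: weyl_word_eigenvectors[OF sym w(1) u] diag[OF w(1)] diag[OF u]
          h_def c_def power_mult_distrib)
    also have "\<dots> = (l ^ k)\<^sup>2 * ((real k + 1)\<^sup>2 * (m / l) ^ k * K)"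
      using m0 ml by (simp add: K_def power_divide power2_eq_square field_simps)
    finally show ?thesis using m0 ml by simp
  qed
  have "(\<lambda>k. (real k + 1)\<^sup>2 * (m / l) ^ k * K) \<longlonglongrightarrow> 0"
  proof -
    \<comment> \<open>The square root absorbs the factor \<open>(real k + 1)\<^sup>2\<close>: the
      sequence is \<open>K\<close> times the square of \<open>(real k + 1) * r ^ k\<close>, and
      \<open>k * r ^ k\<close> tends to 0.\<close>
    define r where "r = sqrt (m / l)"
    have r: "0 \<le> r" "r < 1" "m / l = r\<^sup>2" using m0 ml by (auto simp: r_def)
    have "(\<lambda>k. real k * r ^ k + r ^ k) \<longlonglongrightarrow> 0 + 0"
      using r by (intro tendsto_add powser_times_n_limit_0 LIMSEQ_realpow_zero) auto
    then have "(\<lambda>k. (real k * r ^ k + r ^ k)\<^sup>2 * K) \<longlonglongrightarrow> (0 + 0)\<^sup>2 * K"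
      by (intro tendsto_mult tendsto_power tendsto_const)
    moreover have "(real k * r ^ k + r ^ k)\<^sup>2 = (real k + 1)\<^sup>2 * (m / l) ^ k" for k
    proof -
      have "real k * r ^ k + r ^ k = (real k + 1) * r ^ k" by (simp add: algebra_simps)
      then show ?thesis by (simp add: r(3) power_mult_distrib power_mult[symmetric] mult.commute)
    qed
    ultimately show ?thesis by simp
  qed
  then have "c\<^sup>2 \<le> 0"
    by (rule LIMSEQ_le_const) (use bound in blast)
  then show ?thesis by (simp add: c_def)
qed

text \<open>Between eigenvectors the commutator has entries
  \<open>(m - l) * (w \<bullet> (Y *v u))\<close>, which vanish for equal eigenvalues trivially and
  for distinct ones by the preceding lemma. Eigenvectors span, so the commutator is 0.\<close>

lemma weyl_words_pos_semidef_imp_commute: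
  fixes X Y :: "real^'n^'n"
  assumes X: "pos_semidef X" and Y: "transpose Y = Y"
    and words: "\<And>k. k \<ge> 1 \<Longrightarrow> pos_semidef (weyl_word k X Y)"
  shows "X ** Y = Y ** X"
proof -
  define E where "E = {u. \<exists>l. X *v u = l *\<^sub>R u}"
  have sym: "transpose X = X" using X by (simp add: pos_semidef_def)
  have span: "span E = UNIV"
    unfolding E_def by (rule span_eigenvectors_symmetric[OF sym])
  define D where "D = X ** Y - Y ** X"
  have *: "w \<bullet> (D *v u) = 0" if wu: "w \<in> E" "u \<in> E" for w u
  proof -
    obtain m l where m: "X *v w = m *\<^sub>R w" and l: "X *v u = l *\<^sub>R u"
      using wu E_def by blast
    have "(m - l) * (w \<bullet> (Y *v u)) = 0"
    \<comment> \<open>\<open>E\<close> also contains 0, which has no determined eigenvalue.\<close>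
    proof (cases "w = 0 \<or> u = 0")
      case False
      consider "m < l" | "l < m" | "m = l" by linarith
      then show ?thesis
      proof cases
        case 1
        then show ?thesis
          using weyl_word_eigenvectors_orthogonal[OF X words m _ l] False by simp
      next
        \<comment> \<open>With the roles of \<open>w\<close> and \<open>u\<close> exchanged one gets
          \<open>u \<bullet> (Y *v w) = 0\<close>; symmetry of \<open>Y\<close> turns it
          back.\<close>
        case 2
        then show ?thesis
          using weyl_word_eigenvectors_orthogonal[OF X words l _ m] False
            symmetric_inner_swap[OF Y, of w u] by (simp add: inner_commute)
      qed simp
    qed auto
    then show ?thesis
      by (simp add: D_def matrix_vector_mult_diff_rdistrib matrix_vector_mul_assoc[symmetric]
          inner_diff_right symmetric_inner_swap[OF sym] m l matrix_vector_mult_scaleR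
          algebra_simps)
  qed
  have D0: "D *v u = 0" if "u \<in> E" for u
  proof -
    have "orthogonal (D *v u) z" for z
      by (rule orthogonal_to_span[of _ E])
        (use span * that in \<open>auto simp: orthogonal_def inner_commute\<close>)
    then show ?thesis using orthogonal_self by blast
  qed
  have "D *v z = 0" for z
    by (rule linear_eq_0_on_span[of "(*v) D" E z]) (use span D0 in auto)
  then have "(X ** Y) *v z = (Y ** X) *v z" for z
    by (simp add: D_def matrix_vector_mult_diff_rdistrib)
  then show ?thesis by (simp add: matrix_eq)
qed

section \<open>Extreme rays of a pointed cone\<close>

text \<open>The hull of the unit vectors of the cone is compact and misses 0, so a hyperplane
  separates it strictly from 0; homogeneity does the rest. The uniform constant \<open>b\<close>
  later bounds the base \<open>a \<bullet> x = 1\<close>.\<close>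

lemma pointed_cone_positive_functional:
  fixes \<Gamma> :: "'a::euclidean_space set"
  assumes cone: "convex_cone \<Gamma>" and "closed \<Gamma>" and line: "\<not> contains_line \<Gamma>"
  obtains a b where "b > 0" "\<And>x. x \<in> \<Gamma> \<Longrightarrow> b * norm x \<le> a \<bullet> x"
proof -
  have sc: "\<And>c x. 0 \<le> c \<Longrightarrow> x \<in> \<Gamma> \<Longrightarrow> c *\<^sub>R x \<in> \<Gamma>"
    using cone by (simp add: convex_cone_scaleR)
  \<comment> \<open>This is where pointedness enters: if 0 were a convex combination of nonzero
    \<open>x\<close> and \<open>y\<close>, then \<open>- x\<close>, and so the whole line through 0
    and \<open>x\<close>, would lie in the cone.\<close>
  have conv: "convex (\<Gamma> - {0})"
    unfolding convex_alt
  proof (intro ballI allI impI)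
    fix x y and t :: real
    assume x: "x \<in> \<Gamma> - {0}" and y: "y \<in> \<Gamma> - {0}" and t: "0 \<le> t \<and> t \<le> 1"
    have "(1 - t) *\<^sub>R x + t *\<^sub>R y \<noteq> 0"
    proof
      assume eq: "(1 - t) *\<^sub>R x + t *\<^sub>R y = 0"
      have t1: "t < 1"
      proof (rule ccontr)
        assume "\<not> t < 1"
        then have "t = 1" using t by simp
        then show False using eq y by simp
      qed
      have "(1 - t) *\<^sub>R (- x) = t *\<^sub>R y" using eq by (simp add: algebra_simps add_eq_0_iff)
      then have "(1 - t) *\<^sub>R (- x) \<in> \<Gamma>" using sc y t by simp
      from sc[OF _ this, of "inverse (1 - t)"] have mx: "- x \<in> \<Gamma>"
        using t1 by (simp del: scaleR_minus_right)
      have "0 + s *\<^sub>R x \<in> \<Gamma>" for s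
        using sc[of s x] sc[of "- s" "- x"] x mx by (cases "s \<ge> 0") auto
      then show False using line x unfolding contains_line_def by blast
    qed
    moreover have "(1 - t) *\<^sub>R x + t *\<^sub>R y \<in> \<Gamma>"
      using x y t by (intro convex_cone_add[OF cone] sc) auto
    ultimately show "(1 - t) *\<^sub>R x + t *\<^sub>R y \<in> \<Gamma> - {0}" by blast
  qed
  let ?S = "convex hull (\<Gamma> \<inter> sphere 0 1)"
  have "compact ?S"
    by (intro compact_convex_hull closed_Int_compact \<open>closed \<Gamma>\<close> compact_sphere)
  moreover have "?S \<subseteq> \<Gamma> - {0}"
    by (rule hull_minimal) (use conv in auto)
  ultimately obtain a b where ab: "b > 0" "\<And>x. x \<in> ?S \<Longrightarrow> b < a \<bullet> x"
    using separating_hyperplane_closed_0[of ?S] by (metis DiffE compact_imp_closed convex_convex_hull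
        insertI1 subsetD)
  have "b * norm x \<le> a \<bullet> x" if "x \<in> \<Gamma>" for x
  proof (cases "x = 0")
    case False
    then have "x /\<^sub>R norm x \<in> ?S"
      using that sc by (intro hull_inc) simp
    from ab(2)[OF this] show ?thesis using False by (simp add: field_simps)
  qed simp
  then show thesis using that ab by blast
qed

text \<open>A segment of the cone through a point of the ray, with nonzero endpoints, rescales to
  the base: \<open>e\<close> becomes a proper convex combination of the rescaled endpoints, which
  extremality makes equal to \<open>e\<close>.\<close>

lemma extreme_point_of_base_imp_extreme_ray:
  fixes \<Gamma> :: "'a::euclidean_space set"
  assumes cone: "convex_cone \<Gamma>" and pos: "\<And>x. x \<in> \<Gamma> \<Longrightarrow> x \<noteq> 0 \<Longrightarrow> 0 < a \<bullet> x"
    and e: "e extreme_point_of (\<Gamma> \<inter> {x. a \<bullet> x = 1})"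
  shows "{t *\<^sub>R e | t. t \<ge> 0} extreme_ray_of \<Gamma>" (is "?R extreme_ray_of _")
proof -
  have eG: "e \<in> \<Gamma>" "a \<bullet> e = 1" using e by (auto simp: extreme_point_of_def)
  have "convex ?R"
  proof -
    have "?R = (\<lambda>t. t *\<^sub>R e) ` {0..}" by auto
    then show ?thesis by (simp add: convex_scaled convex_linear_image)
  qed
  moreover have "?R \<subseteq> \<Gamma>" using eG cone by (auto simp: convex_cone_scaleR)
  moreover have "x \<in> ?R \<and> y \<in> ?R"
    if xy: "x \<in> \<Gamma>" "y \<in> \<Gamma>" and z: "z \<in> ?R" "z \<in> open_segment x y" for x y z
  proof -
    obtain t where t: "t \<ge> 0" "z = t *\<^sub>R e" using z by blast
    obtain s where s: "0 < s" "s < 1" "z = (1 - s) *\<^sub>R x + s *\<^sub>R y"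
      using z by (auto simp: in_segment)
    have zero: "0 \<in> ?R" by (auto intro: exI[of _ 0])
    have scaled: "p \<in> ?R" if "r *\<^sub>R p = q *\<^sub>R e" "r > 0" "q \<ge> 0" for p r q
    proof -
      have "p = (q / r) *\<^sub>R e"
        using that by (metis divide_inverse_commute less_irrefl scaleR_one scaleR_scaleR
            left_inverse)
      then show ?thesis using that by auto
    qed
    show ?thesis
    \<comment> \<open>A zero endpoint cannot be rescaled to the base; the other endpoint is then a
      nonnegative multiple of \<open>e\<close> directly.\<close>
    proof (cases "x = 0 \<or> y = 0")
      case True
      then show ?thesis
      proof
        assume "x = 0"
        then show ?thesis using zero scaled[of s y t] s t by auto
      next
        assume "y = 0"
        then show ?thesis using zero scaled[of "1 - s" x t] s t by auto
      qed
    next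
      case False
      define \<alpha> where "\<alpha> = a \<bullet> x"
      define \<beta> where "\<beta> = a \<bullet> y"
      have ab: "\<alpha> > 0" "\<beta> > 0" using False pos xy by (auto simp: \<alpha>_def \<beta>_def)
      have "a \<bullet> z = t" using t eG by simp
      then have t_eq: "t = (1 - s) * \<alpha> + s * \<beta>"
        using s by (simp add: inner_add_right \<alpha>_def \<beta>_def)
      then have t0: "t > 0" using ab s by (simp add: add_pos_pos)
      define x' where "x' = x /\<^sub>R \<alpha>"
      define y' where "y' = y /\<^sub>R \<beta>"
      have xs: "x = \<alpha> *\<^sub>R x'" "y = \<beta> *\<^sub>R y'" using ab by (auto simp: x'_def y'_def)
      have base: "x' \<in> \<Gamma> \<inter> {x. a \<bullet> x = 1}" "y' \<in> \<Gamma> \<inter> {x. a \<bullet> x = 1}"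
        using ab xy cone by (auto simp: x'_def y'_def convex_cone_scaleR \<alpha>_def \<beta>_def)
      \<comment> \<open>The weights \<open>(1 - s) * \<alpha>\<close> and \<open>s * \<beta>\<close>
        of \<open>x'\<close> and \<open>y'\<close> in \<open>z\<close> add up to \<open>t\<close>;
        division by \<open>t\<close> normalizes them.\<close>
      define r where "r = s * \<beta> / t"
      have "0 < (1 - s) * \<alpha>" using s ab by simp
      then have r: "0 < r" "r < 1" using s(1) ab t0 t_eq by (simp_all add: r_def)
      have r1: "1 - r = (1 - s) * \<alpha> / t" using t0 t_eq by (simp add: r_def field_simps)
      have "e = (1 / t) *\<^sub>R z" using t t0 by simp
      also have "\<dots> = (1 - r) *\<^sub>R x' + r *\<^sub>R y'"
        unfolding r1 unfolding s(3) r_def by (simp add: scaleR_add_right xs)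
      finally have e_eq: "e = (1 - r) *\<^sub>R x' + r *\<^sub>R y'" .
      have "x' = y'"
      proof (rule ccontr)
        assume "x' \<noteq> y'"
        then have "e \<in> open_segment x' y'" using e_eq r by (auto simp: in_segment)
        then show False using e base by (auto simp: extreme_point_of_def)
      qed
      then have "x' = e" "y' = e" using e_eq by (auto simp: algebra_simps)
      then show ?thesis using xs ab by (auto intro: less_imp_le)
    qed
  qed
  ultimately have "?R face_of \<Gamma>" unfolding face_of_def by blast
  moreover have "e \<noteq> 0" using eG by auto
  ultimately show ?thesis unfolding extreme_ray_of_def by blast
qed

lemma dual_cone_if_nonneg_on_extreme_rays:
  fixes \<Gamma> :: "'a::euclidean_space set"
  assumes cone: "convex_cone \<Gamma>" and closed: "closed \<Gamma>" and line: "\<not> contains_line \<Gamma>"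
    and nonneg: "\<And>R p. R extreme_ray_of \<Gamma> \<Longrightarrow> p \<in> R \<Longrightarrow> 0 \<le> y \<bullet> p"
  shows "y \<in> dual_cone \<Gamma>"
proof -
  obtain a b where b: "b > 0" and ab: "\<And>x. x \<in> \<Gamma> \<Longrightarrow> b * norm x \<le> a \<bullet> x"
    using pointed_cone_positive_functional[OF cone closed line] by blast
  have pos: "0 < a \<bullet> x" if "x \<in> \<Gamma>" "x \<noteq> 0" for x
    using ab[OF that(1)] b that(2) by (smt (verit) mult_pos_pos zero_less_norm_iff)
  define B where "B = \<Gamma> \<inter> {x. a \<bullet> x = 1}"
  \<comment> \<open>On \<open>B\<close> the functional is 1, so norms are at most
    \<open>1 / b\<close>.\<close>
  have "bounded B"
    unfolding bounded_iff
    using ab b by (intro exI[of _ "1 / b"]) (fastforce simp: B_def field_simps)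
  moreover have "closed B" unfolding B_def by (intro closed_Int closed closed_hyperplane)
  ultimately have "compact B" by (simp add: compact_eq_bounded_closed)
  moreover have "convex B"
    unfolding B_def using cone by (intro convex_Int convex_hyperplane) (simp add: convex_cone_def)
  ultimately have "B = convex hull {x. x extreme_point_of B}"
    by (rule Krein_Milman_Minkowski)
  also have "\<dots> \<subseteq> {x. y \<bullet> x \<ge> 0}"
  proof (rule hull_minimal)
    show "{x. x extreme_point_of B} \<subseteq> {x. 0 \<le> y \<bullet> x}"
    proof clarify
      fix e assume "e extreme_point_of B"
      then have "{t *\<^sub>R e | t. t \<ge> 0} extreme_ray_of \<Gamma>"
        using extreme_point_of_base_imp_extreme_ray[OF cone pos] unfolding B_def by blast
      then show "0 \<le> y \<bullet> e"
        by (rule nonneg) (auto intro: exI[of _ 1])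
    qed
  qed (rule convex_halfspace_ge)
  finally have B: "B \<subseteq> {x. y \<bullet> x \<ge> 0}" .
  have "0 \<le> y \<bullet> x" if "x \<in> \<Gamma>" for x
  proof (cases "x = 0")
    case False
    have ax: "0 < a \<bullet> x" using pos that False by blast
    then have "x /\<^sub>R (a \<bullet> x) \<in> B"
      using that cone by (simp add: B_def convex_cone_scaleR)
    then have "0 \<le> y \<bullet> (x /\<^sub>R (a \<bullet> x))" using B by blast
    then show ?thesis using ax by (simp add: zero_le_mult_iff field_simps)
  qed simp
  then show ?thesis by (simp add: dual_cone_def)
qed

section \<open>Linear pencils\<close>

lemma lin_pencil_axis: "lin_pencil A (axis j 1) = A j"
proof -
  have "lin_pencil A (axis j 1) = (\<Sum>i\<in>UNIV. if i = j then A i else 0)"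
    unfolding lin_pencil_def by (intro sum.cong refl) (simp add: axis_def)
  then show ?thesis by simp
qed

lemma linear_lin_pencil: "linear (lin_pencil A)"
  unfolding lin_pencil_def
  by (intro linearI) (simp_all add: scaleR_add_left sum.distrib scaleR_sum_right)

text \<open>Links the dual cone to the spectrum: the value at \<open>p\<close> of the functional
  given by \<open>\<mu>\<close> is an eigenvalue of the pencil at \<open>p\<close>.\<close>

lemma lin_pencil_eigenvector:
  assumes "\<And>j. A j *v u = (\<mu> $ j) *\<^sub>R u"
  shows "lin_pencil A p *v u = (\<mu> \<bullet> p) *\<^sub>R u"
  by (simp add: lin_pencil_def matrix_vector_mult_sum_left scaleR_matrix_vector_assoc[symmetric] assms
      inner_vec_def scaleR_sum_left mult.commute)

lemma matrix_add_rdistrib: "(B + C) ** A = B ** A + C ** (A :: real^'n^'m)"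
  by (vector matrix_matrix_mult_def sum.distrib[symmetric] field_simps)

text \<open>Commuting with a fixed \<open>M\<close> is a linear condition on \<open>x\<close>, so it
  can be checked on a spanning set.\<close>

lemma subspace_lin_pencil_centralizer:
  "subspace {x. lin_pencil A x ** M = M ** lin_pencil A x}"
  by (auto simp: subspace_def linear_0[OF linear_lin_pencil] linear_add[OF linear_lin_pencil]
      linear_scale[OF linear_lin_pencil] matrix_add_ldistrib matrix_add_rdistrib
      scalar_matrix_assoc[symmetric] matrix_scalar_ac)

lemma lin_pencil_commute:
  fixes A :: "'d::finite \<Rightarrow> real^'n^'n" and v :: "'d \<Rightarrow> real^'d"
  assumes v: "inj v" "independent (range v)"
    and comm: "\<And>i j. lin_pencil A (v i) ** lin_pencil A (v j) = lin_pencil A (v j) ** lin_pencil A (v i)"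
  shows "A i ** A j = A j ** A i"
proof -
  have "card (range v) = dim (UNIV :: (real^'d) set)"
    using v by (simp add: card_image)
  then have span: "span (range v) = UNIV"
    using v card_eq_dim[of "range v" UNIV] by auto
  have extend: "lin_pencil A x ** M = M ** lin_pencil A x"
    if "\<And>i. lin_pencil A (v i) ** M = M ** lin_pencil A (v i)" for x M
  proof -
    have "range v \<subseteq> {x. lin_pencil A x ** M = M ** lin_pencil A x}" using that by blast
    from span_minimal[OF this subspace_lin_pencil_centralizer] show ?thesis
      unfolding span by blast
  qed
  have "lin_pencil A x ** lin_pencil A y = lin_pencil A y ** lin_pencil A x" for x y
    \<comment> \<open>Extends from the \<open>v i\<close> to all vectors twice: first in
      \<open>x\<close> with \<open>y\<close> fixed, then in \<open>y\<close> with one argument some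
      \<open>v i\<close>.\<close>
    by (rule extend, rule extend[symmetric], rule comm)
  from this[of "axis i 1" "axis j 1"] show ?thesis by (simp only: lin_pencil_axis)
qed

theorem theorem7p2:
  fixes \<Gamma> :: "(real^'d) set"
    and A :: "'d \<Rightarrow> real^'n^'n"
  assumes "convex_cone \<Gamma>" and "closed \<Gamma>"
    and "\<not> contains_line \<Gamma>"
    and "interior \<Gamma> \<noteq> {}"
    and "\<And>j. transpose (A j) = A j"
    and "\<And>R p. R extreme_ray_of \<Gamma> \<Longrightarrow> p \<in> R \<Longrightarrow> pos_semidef (lin_pencil A p)"
    and "\<exists>v :: 'd \<Rightarrow> real^'d.
           inj v \<and> independent (range v) \<and>
           (\<forall>i. \<exists>R. R extreme_ray_of \<Gamma> \<and> v i \<in> R) \<and>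
           (\<forall>i j k. k \<ge> 1 \<longrightarrow>
              pos_semidef (weyl_word k (lin_pencil A (v i)) (lin_pencil A (v j))))"
  shows "(\<forall>i j. A i ** A j = A j ** A i) \<and>
         (\<forall>\<mu>. joint_eigenvalue A \<mu> \<longrightarrow> \<mu> \<in> dual_cone \<Gamma>)"
proof -
  obtain v :: "'d \<Rightarrow> real^'d" where v: "inj v" "independent (range v)"
    and ray: "\<And>i. \<exists>R. R extreme_ray_of \<Gamma> \<and> v i \<in> R"
    and words: "\<And>i j k. k \<ge> 1 \<Longrightarrow>
      pos_semidef (weyl_word k (lin_pencil A (v i)) (lin_pencil A (v j)))"
    using assms(7) by blast
  have psd: "pos_semidef (lin_pencil A (v i))" for i
    using ray assms(6) by blast
  have "lin_pencil A (v i) ** lin_pencil A (v j) = lin_pencil A (v j) ** lin_pencil A (v i)" for i j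
  proof (rule weyl_words_pos_semidef_imp_commute[OF psd _ words])
    show "transpose (lin_pencil A (v j)) = lin_pencil A (v j)"
      using psd[of j] unfolding pos_semidef_def by (rule conjunct1)
  qed
  then have "A i ** A j = A j ** A i" for i j
    by (rule lin_pencil_commute[OF v])
  moreover have "\<mu> \<in> dual_cone \<Gamma>" if eig: "joint_eigenvalue A \<mu>" for \<mu>
  proof (rule dual_cone_if_nonneg_on_extreme_rays[OF assms(1-3)])
    fix R p assume R: "R extreme_ray_of \<Gamma>" "p \<in> R"
    obtain u where u: "u \<noteq> 0" "\<And>j. A j *v u = (\<mu> $ j) *\<^sub>R u"
      using eig unfolding joint_eigenvalue_def by blast
    show "0 \<le> \<mu> \<bullet> p"
      \<comment> \<open>\<open>\<mu> \<bullet> p\<close> is an eigenvalue, with eigenvector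
        \<open>u\<close>, of the pencil at \<open>p\<close>, which is semidefinite because
        \<open>p\<close> lies on an extreme ray.\<close>
      by (rule pos_semidef_eigenvalue_nonneg[OF assms(6)[OF R] lin_pencil_eigenvector[OF u(2)] u(1)])
  qed
  ultimately show ?thesis by blast
qed

end
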